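(* Let $d\in\mathbb{Q}[x]$ with $\deg(d)=1$ and let $g\in\mathbb{Q}$ be a non-zero constant. Let $(\mathcal{F}_n)_{n\ge 0}$ be the associated Fibonacci-type sequence, $\beta=\mathrm{lc}(d)$, $\rho=\mathrm{Res}(g,d)$, and let $d'$ be the derivative of $d$. Then for every integer $n\ge 2$, $$\mathrm{Disc}(\mathcal{F}_n)=(-\rho)^{(n-2)(n-1)/2}\,(2d')^{n-1}\,n^{n-3}\,\beta^{(n-1)(n-3)}.$$
   Context: The Fibonacci-type sequence associated with $d,g$ is defined by $\mathcal{F}_0=0$, $\mathcal{F}_1=1$, $\mathcal{F}_n=d\,\mathcal{F}_{n-1}+g\,\mathcal{F}_{n-2}$ for $n\ge 2$. $\mathrm{lc}(P)$ denotes the leading coefficient of $P$. For non-zero $P,Q\in\mathbb{Q}[x]$, $\mathrm{Res}(P,Q)$ is the determinant of the Sylvester matrix of $P,Q$; equivalently, if $P$ has degree $n$, leading coefficient $a_n$ and complex roots $x_1,\dots,x_n$ (with multiplicity), then $\mathrm{Res}(P,Q)=a_n^{\deg Q}\prod_{i=1}^n Q(x_i)$. In particular $\mathrm{Res}(k,f)=\mathrm{Res}(f,k)=k^{\deg f}$ for a non-zero constant $k$. For $P$ of degree $n\ge1$ with leading coefficient $a_n$, $\mathrm{Disc}(P)=(-1)^{n(n-1)/2}a_n^{-1}\,\mathrm{Res}(P,P')$. Since $\deg(d)=1$, $d'$ is a constant. *)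

theory Defs
  imports "Subresultants.Resultant_Prelim"
begin

fun fib_poly :: "'a::comm_ring_1 poly \<Rightarrow> 'a poly \<Rightarrow> nat \<Rightarrow> 'a poly" where
  "fib_poly d g 0 = 0"
| "fib_poly d g (Suc 0) = 1"
| "fib_poly d g (Suc (Suc n)) = d * fib_poly d g (Suc n) + g * fib_poly d g n"

(* Intended for degree P \<ge> 1. The library's resultant is the determinant of the Sylvester
   matrix. In characteristic 0 we have degree (pderiv P) = degree P - 1, so no power of the
   leading coefficient is lost; hence the class field_char_0. *)
definition poly_disc :: "'a::field_char_0 poly \<Rightarrow> 'a" where
  "poly_disc P =
     (-1) ^ (degree P * (degree P - 1) div 2) * inverse (lead_coeff P) * resultant P (pderiv P)"

end

(* Write b = lc d, D = d^2 + 4g, F_n for the polynomials. The resultant of P and Q is, up to a power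
   of lc P, the product of Q over the roots of P; so it is multiplicative in Q and depends only on
   Q mod P. Now D F_n' = 2 n b g F_(n-1) modulo F_n and 2^(n-1) F_n = n d^(n-1) modulo D, while
   F_(n+1) = g F_(n-1) modulo F_n evaluates Res(F_n, F_(n-1)) recursively. Multiplicativity,
   Res(F_n, D F_n') = Res(F_n, D) Res(F_n, F_n'), then gives the discriminant. *)
theory Submission
  imports "HOL-Algebra.Algebraic_Closure_Type" "Subresultants.Subresultant" Defs
begin

(* As a simplification rule this destroys the pattern [:-x, 1:]. *)
declare pCons_one [simp del]

section \<open>Product formula for the resultant over an algebraically closed field\<close>

text \<open>The Euclidean step for resultants, read off from the behaviour of the subresultant at
  index 0 under division with remainder. Constant and non-constant remainders obey different
  subresultant formulas, hence the case split.\<close>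

lemma resultant_mod:
  fixes P Q :: "'a::field poly"
  assumes "degree Q > 0" and "degree Q \<le> degree P"
  shows "resultant P Q = (-1) ^ (degree P * degree Q) *
    lead_coeff Q ^ (degree P - degree (P mod Q)) * resultant Q (P mod Q)"
proof -
  let ?H = "P mod Q"
  have eq: "P + (- (P div Q)) * Q = ?H"
    by (simp add: minus_div_mult_eq_mod)
  have Q: "Q \<noteq> 0" using assms(1) by auto
  have lt: "degree ?H < degree Q" using degree_mod_less'[OF Q] assms(1) by (cases "?H = 0") auto
  show ?thesis
  proof (cases "degree ?H = 0")
    case False
    have "subresultant 0 P Q = smult ((-1) ^ (degree P * degree Q) *
        lead_coeff Q ^ (degree P - degree ?H)) (subresultant 0 Q ?H)"
      using BT_lemma_1_12[OF eq assms(2) disjI1[OF lt], of 0] False by simp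
    then show ?thesis by (simp add: subresultant_resultant)
  next
    case True
    then obtain h where h: "?H = [:h:]" by (elim degree_eq_zeroE)
    have "subresultant 0 P Q = smult ((-1) ^ (degree P * degree Q) *
        lead_coeff Q ^ degree P * lead_coeff ?H ^ (degree Q - 1)) ?H"
      using BT_lemma_1_13[OF eq assms(2) disjI1[OF lt] disjI1[OF lt]] True by simp
    then have "resultant P Q = (-1) ^ (degree P * degree Q) *
        lead_coeff Q ^ degree P * (h ^ (degree Q - 1) * h)"
      by (simp add: subresultant_resultant h)
    \<comment> \<open>The subresultant is a multiple of the constant remainder itself, which
      supplies the last factor \<open>h\<close>; since \<open>degree Q > 0\<close>, the powers
      combine even when \<open>h = 0\<close>.\<close>
    also have "h ^ (degree Q - 1) * h = h ^ degree Q"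
      using assms(1) by (metis power_minus_mult)
    finally show ?thesis by (simp add: h mult.assoc)
  qed
qed

lemma poly_prod_mset_linear: "poly (\<Prod>x\<in>#A. [:-x, 1:]) y = (\<Prod>x\<in>#A. y - x)"
  for y :: "'a::comm_ring_1"
  by (induction A) (simp_all add: algebra_simps)

lemma degree_prod_mset_linear: "degree (\<Prod>x\<in>#A. [:-x, 1:]) = size A"
  for A :: "'a::idom multiset"
proof (induction A)
  case (add x A)
  have "(\<Prod>x\<in>#A. [:-x, 1:]) \<noteq> 0" by (auto simp: prod_mset_zero_iff)
  then show ?case using add by (simp add: degree_mult_eq del: mult_pCons_left)
qed simp

lemma lead_coeff_prod_mset_linear: "lead_coeff (\<Prod>x\<in>#A. [:-x, 1:]) = 1"
  for A :: "'a::idom multiset"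
  by (induction A) (simp_all add: lead_coeff_mult del: mult_pCons_left)

lemma prod_mset_minus_swap:
  "(\<Prod>x\<in>#A. \<Prod>y\<in>#B. x - y) = (-1) ^ (size A * size B) * (\<Prod>y\<in>#B. \<Prod>x\<in>#A. y - x)"
  for A B :: "'a::comm_ring_1 multiset"
proof -
  have *: "(\<Prod>y\<in>#B. x - y) = (-1) ^ size B * (\<Prod>y\<in>#B. y - x)" for x
    by (induction B) (simp_all add: algebra_simps)
  have "(\<Prod>x\<in>#A. \<Prod>y\<in>#B. x - y) = (-1) ^ (size A * size B) * (\<Prod>x\<in>#A. \<Prod>y\<in>#B. y - x)"
    by (induction A) (simp_all add: * power_add algebra_simps)
  also have "(\<Prod>x\<in>#A. \<Prod>y\<in>#B. y - x) = (\<Prod>y\<in>#B. \<Prod>x\<in>#A. y - x)"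
    by (rule prod_mset.swap)
  finally show ?thesis .
qed

text \<open>Both sides equal \<open>a ^ degree Q * b ^ degree P\<close> times the product of all
  differences \<open>x - y\<close>. This is the counterpart of \<open>resultant_swap\<close> on the
  side of the root products.\<close>

lemma prod_roots_swap:
  fixes P Q :: "'a::idom poly"
  assumes P: "P = smult a (\<Prod>x\<in>#A. [:-x, 1:])" and Q: "Q = smult b (\<Prod>y\<in>#B. [:-y, 1:])"
    and "a \<noteq> 0" "b \<noteq> 0"
  shows "a ^ degree Q * (\<Prod>x\<in>#A. poly Q x) =
    (-1) ^ (degree P * degree Q) * (b ^ degree P * (\<Prod>y\<in>#B. poly P y))"
proof -
  have deg: "degree P = size A" "degree Q = size B"
    using assms by (simp_all add: degree_prod_mset_linear)
  have "(\<Prod>x\<in>#A. poly Q x) = b ^ size A * (\<Prod>x\<in>#A. \<Prod>y\<in>#B. x - y)"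
    by (simp add: Q poly_prod_mset_linear prod_mset.distrib)
  moreover have "(\<Prod>y\<in>#B. poly P y) = a ^ size B * (\<Prod>y\<in>#B. \<Prod>x\<in>#A. y - x)"
    by (simp add: P poly_prod_mset_linear prod_mset.distrib)
  ultimately show ?thesis
    by (simp add: deg prod_mset_minus_swap[where A = A and B = B])
qed

text \<open>Induction along the Euclidean algorithm: taking a remainder and exchanging the arguments
  change the resultant and the root product by the same factors, down to constant
  \<open>Q\<close>.\<close>

lemma resultant_eq_prod_roots:
  fixes P Q :: "'a::alg_closed_field poly"
  assumes "P = smult a (\<Prod>x\<in>#A. [:-x, 1:])" and "a \<noteq> 0"
  shows "resultant P Q = a ^ degree Q * (\<Prod>x\<in>#A. poly Q x)"
  using assms
\<comment> \<open>The weight 2 on \<open>degree Q\<close> makes the measure drop both for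
  \<open>(Q, P mod Q)\<close> and for the plain exchange \<open>(Q, P)\<close> when
  \<open>degree P < degree Q\<close>.\<close>
proof (induction "2 * degree Q + degree P" arbitrary: P Q a A rule: less_induct)
  case less
  note P = less.prems(1) and a = less.prems(2)
  have degP: "degree P = size A" using P a by (simp add: degree_prod_mset_linear)
  show ?case
  proof (cases "degree Q = 0")
    case True
    then obtain c where "Q = [:c:]" by (elim degree_eq_zeroE)
    then have "image_mset (poly Q) A = image_mset (\<lambda>_. c) A"
      by (intro image_mset_cong) simp
    then show ?thesis using \<open>Q = [:c:]\<close> by (simp add: degP)
  next
    case False
    then have "Q \<noteq> 0" by auto
    then obtain b B where b: "b \<noteq> 0" and Q: "Q = smult b (\<Prod>y\<in>#B. [:-y, 1:])"
      using alg_closed_imp_factorization[of Q] by (metis leading_coeff_0_iff)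
    have swap: "a ^ degree Q * (\<Prod>x\<in>#A. poly Q x) =
        (-1) ^ (degree P * degree Q) * (b ^ degree P * (\<Prod>y\<in>#B. poly P y))"
      by (rule prod_roots_swap[OF P Q a b])
    have root: "poly Q y = 0" if "y \<in># B" for y
      using that by (auto simp: Q poly_prod_mset_linear prod_mset_zero_iff)
    have lcQ: "lead_coeff Q = b"
      unfolding Q lead_coeff_smult lead_coeff_prod_mset_linear by simp
    show ?thesis
    proof (cases "degree Q \<le> degree P")
      case True
      let ?H = "P mod Q"
      have lt: "degree ?H < degree Q"
        using degree_mod_less'[OF \<open>Q \<noteq> 0\<close>] False by (cases "?H = 0") auto
      have "resultant Q ?H = b ^ degree ?H * (\<Prod>y\<in>#B. poly ?H y)"
        by (rule less.hyps[OF _ Q b]) (use lt True in linarith)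
      \<comment> \<open>A polynomial and its remainder modulo \<open>Q\<close> agree at the roots of
        \<open>Q\<close>.\<close>
      moreover have "(\<Prod>y\<in>#B. poly ?H y) = (\<Prod>y\<in>#B. poly P y)"
        by (intro arg_cong[of _ _ prod_mset] image_mset_cong) (simp add: poly_mod root)
      moreover have "b ^ (degree P - degree ?H) * b ^ degree ?H = b ^ degree P"
        using lt True by (simp flip: power_add)
      ultimately show ?thesis
        using resultant_mod[of Q P] False True by (simp add: swap lcQ mult.assoc)
    next
      case 2: False
      have "resultant Q P = b ^ degree P * (\<Prod>y\<in>#B. poly P y)"
        by (rule less.hyps[OF _ Q b]) (use 2 in linarith)
      then show ?thesis
        using resultant_swap[of P Q] by (simp add: swap)
    qed
  qed
qed

section \<open>Multiplicativity and congruence of resultants over any field\<close>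

interpretation to_ac: field_hom "to_ac :: 'a::field \<Rightarrow> 'a alg_closure"
  by unfold_locales auto

interpretation to_ac_poly: map_poly_idom_hom "to_ac :: 'a::field \<Rightarrow> 'a alg_closure" ..

text \<open>A single multiset of roots serves every \<open>Q\<close>, so resultants of the same
  \<open>P\<close> with different second arguments can be compared factor by factor.\<close>

lemma resultant_roots_alg_closure:
  fixes P :: "'a::field poly"
  assumes "P \<noteq> 0"
  obtains A where "\<And>x. x \<in># A \<Longrightarrow> poly (map_poly to_ac P) x = 0"
    and "\<And>Q. to_ac (resultant P Q) =
      to_ac (lead_coeff P) ^ degree Q * (\<Prod>x\<in>#A. poly (map_poly to_ac Q) x)"
proof -
  have "map_poly to_ac P \<noteq> 0" using assms by simp
  then obtain A where A:
    "map_poly to_ac P = smult (to_ac (lead_coeff P)) (\<Prod>x\<in>#A. [:-x, 1:])"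
    using alg_closed_imp_factorization[of "map_poly to_ac P"] by auto
  show ?thesis
  proof (rule that[of A])
    show "poly (map_poly to_ac P) x = 0" if "x \<in># A" for x
      unfolding A using that by (auto simp: poly_prod_mset_linear prod_mset_zero_iff)
    show "to_ac (resultant P Q) =
        to_ac (lead_coeff P) ^ degree Q * (\<Prod>x\<in>#A. poly (map_poly to_ac Q) x)" for Q
      using resultant_eq_prod_roots[OF A, of "map_poly to_ac Q"] assms
      by (simp add: to_ac.resultant_hom)
  qed
qed

text \<open>In the product formula the values at the roots multiply and the degrees of nonzero
  factors add; injectivity of \<open>to_ac\<close> brings the identity back to the base
  field.\<close>

lemma resultant_mult_right:
  fixes P Q R :: "'a::field poly"
  assumes "P \<noteq> 0" "Q \<noteq> 0" "R \<noteq> 0"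
  shows "resultant P (Q * R) = resultant P Q * resultant P R"
proof -
  obtain A where "\<And>Q. to_ac (resultant P Q) =
      to_ac (lead_coeff P) ^ degree Q * (\<Prod>x\<in>#A. poly (map_poly to_ac Q) x)"
    using resultant_roots_alg_closure[OF assms(1)] by blast
  then have "to_ac (resultant P (Q * R)) = to_ac (resultant P Q * resultant P R)"
    using assms by (simp add: degree_mult_eq power_add prod_mset.distrib
        to_ac_poly.hom_mult)
  then show ?thesis unfolding to_ac_eq_iff .
qed

lemma resultant_power_right:
  fixes P Q :: "'a::field poly"
  assumes "P \<noteq> 0" "Q \<noteq> 0"
  shows "resultant P (Q ^ n) = resultant P Q ^ n"
  by (induction n) (simp_all add: resultant_mult_right assms)

text \<open>\<open>Q\<close> and \<open>R\<close> take the same values at the roots of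
  \<open>P\<close>, so only the powers of \<open>lead_coeff P\<close> differ; multiplying crosswise
  balances them without division.\<close>

lemma resultant_cong_right:
  fixes P Q R :: "'a::field poly"
  assumes "P \<noteq> 0" and "P dvd Q - R"
  shows "lead_coeff P ^ degree R * resultant P Q = lead_coeff P ^ degree Q * resultant P R"
proof -
  obtain A where root: "\<And>x. x \<in># A \<Longrightarrow> poly (map_poly to_ac P) x = 0"
    and A: "\<And>Q. to_ac (resultant P Q) =
      to_ac (lead_coeff P) ^ degree Q * (\<Prod>x\<in>#A. poly (map_poly to_ac Q) x)"
    using resultant_roots_alg_closure[OF assms(1)] by blast
  obtain K where K: "Q = R + P * K" using assms(2) by (metis dvdE add.commute diff_add_cancel)
  have "(\<Prod>x\<in>#A. poly (map_poly to_ac Q) x) = (\<Prod>x\<in>#A. poly (map_poly to_ac R) x)"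
    by (intro arg_cong[of _ _ prod_mset] image_mset_cong)
      (simp add: K root to_ac_poly.hom_mult hom_distribs)
  then have "to_ac (lead_coeff P ^ degree R * resultant P Q) =
      to_ac (lead_coeff P ^ degree Q * resultant P R)"
    by (simp add: A)
  then show ?thesis unfolding to_ac_eq_iff .
qed

section \<open>Degrees, derivatives and congruences of Fibonacci-type polynomials\<close>

text \<open>As \<open>g\<close> is constant, the term multiplied by \<open>d\<close> strictly
  dominates in the recurrence and its leading term survives.\<close>

lemma degree_lead_coeff_fib_poly:
  fixes d :: "'a::idom poly"
  assumes "degree d = 1"
  shows "degree (fib_poly d [:g:] (Suc n)) = n \<and>
    lead_coeff (fib_poly d [:g:] (Suc n)) = lead_coeff d ^ n"
proof (induction n rule: induct_nat_012)
  case (ge2 n)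
  let ?F = "fib_poly d [:g:]"
  have nz: "d \<noteq> 0" "?F (Suc (Suc n)) \<noteq> 0" using assms ge2 by force+
  then have deg: "degree (d * ?F (Suc (Suc n))) = Suc (Suc n)"
    using assms ge2 by (simp add: degree_mult_eq del: fib_poly.simps)
  have lc: "lead_coeff (d * ?F (Suc (Suc n))) = lead_coeff d ^ Suc (Suc n)"
    using ge2(2)[THEN conjunct2] by (simp only: lead_coeff_mult power_Suc)
  have "degree ([:g:] * ?F (Suc n)) \<le> n"
    using degree_mult_le[of "[:g:]" "?F (Suc n)"] ge2 by simp
  then have lt: "degree ([:g:] * ?F (Suc n)) < degree (d * ?F (Suc (Suc n)))"
    using deg by simp
  have F: "?F (Suc (Suc (Suc n))) = [:g:] * ?F (Suc n) + d * ?F (Suc (Suc n))"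
    by (simp only: fib_poly.simps add.commute)
  show ?case
    using lead_coeff_add_le[OF lt] degree_add_eq_right[OF lt] lc deg
    by (simp only: F)
qed (use assms in auto)

lemmas degree_fib_poly = degree_lead_coeff_fib_poly[THEN conjunct1]
  and lead_coeff_fib_poly = degree_lead_coeff_fib_poly[THEN conjunct2]

lemma fib_poly_nonzero:
  fixes d :: "'a::idom poly"
  assumes "degree d = 1"
  shows "fib_poly d [:g:] (Suc n) \<noteq> 0"
proof -
  have "d \<noteq> 0" using assms by force
  then have "lead_coeff (fib_poly d [:g:] (Suc n)) \<noteq> 0"
    unfolding lead_coeff_fib_poly[OF assms] by simp
  then show ?thesis by force
qed

text \<open>With the Lucas-type companion \<open>L_n = 2 F_(n+1) - d F_n\<close> this reads
  \<open>D F_n' = d' (n L_n - d F_n)\<close>, the derivative of Binet's formula. The induction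
  differentiates the recurrence and multiplies by \<open>D\<close>, so that both hypotheses can be
  substituted.\<close>

lemma fib_poly_pderiv:
  fixes d g :: "'a::idom poly"
  assumes "pderiv g = 0"
  shows "(d\<^sup>2 + 4 * g) * pderiv (fib_poly d g n) =
    pderiv d * (of_nat (2 * n) * fib_poly d g (Suc n) - of_nat (Suc n) * d * fib_poly d g n)"
proof (induction n rule: induct_nat_012)
  case (ge2 n)
  let ?D = "d\<^sup>2 + 4 * g" and ?F = "fib_poly d g"
  have "?D * pderiv (?F (Suc (Suc n))) = pderiv d * ?D * ?F (Suc n) +
      d * (?D * pderiv (?F (Suc n))) + g * (?D * pderiv (?F n))"
    by (simp add: pderiv_add pderiv_mult assms algebra_simps)
  then show ?case
    unfolding ge2 by (simp add: algebra_simps power2_eq_square)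
qed (simp_all add: algebra_simps)

text \<open>The scaled terms \<open>2^n F_(n+1)\<close> have the characteristic polynomial
  \<open>s^2 - 2 d s - 4 g\<close>, which is \<open>(s - d)^2\<close> modulo
  \<open>d^2 + 4 g\<close>; the double root yields the solution \<open>(n+1) d^n\<close>.\<close>

lemma fib_poly_dvd:
  fixes d g :: "'a::comm_ring_1 poly"
  shows "d\<^sup>2 + 4 * g dvd 2 ^ n * fib_poly d g (Suc n) - of_nat (Suc n) * d ^ n"
proof (induction n rule: induct_nat_012)
  case (ge2 n)
  let ?E = "\<lambda>n. 2 ^ n * fib_poly d g (Suc n) - of_nat (Suc n) * d ^ n"
  \<comment> \<open>The error obeys the scaled recurrence up to a multiple of
    \<open>d^2 + 4 g\<close>.\<close>
  have "?E (Suc (Suc n)) =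
      2 * d * ?E (Suc n) + 4 * g * ?E n + of_nat (Suc n) * d ^ n * (d\<^sup>2 + 4 * g)"
    by (simp add: algebra_simps power2_eq_square)
  then show ?case
    using ge2 by (simp only: dvd_add dvd_mult dvd_triv_right)
qed simp_all

section \<open>Resultants of Fibonacci-type polynomials\<close>

lemma resultant_fib_poly_consecutive:
  fixes d :: "'a::field poly"
  assumes d: "degree d = 1" and g: "g \<noteq> 0"
  shows "resultant (fib_poly d [:g:] (Suc (Suc n))) (fib_poly d [:g:] (Suc n)) =
    lead_coeff d ^ (n * Suc n) * g ^ (n * Suc n div 2)"
proof (induction n)
  case (Suc n)
  let ?F = "fib_poly d [:g:]" and ?b = "lead_coeff d"
  have "d \<noteq> 0" using d by force
  then have b: "?b \<noteq> 0" by simp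
  have deg: "degree (?F (Suc k)) = k" for k by (rule degree_fib_poly[OF d])
  have dvd: "?F (Suc (Suc n)) dvd ?F (Suc (Suc (Suc n))) - smult g (?F (Suc n))"
    by simp
  \<comment> \<open>The degrees \<open>n + 2\<close> and \<open>n + 1\<close> have an even product,
    so the exchange costs no sign.\<close>
  have "resultant (?F (Suc (Suc (Suc n)))) (?F (Suc (Suc n))) =
      resultant (?F (Suc (Suc n))) (?F (Suc (Suc (Suc n))))"
    by (subst resultant_swap) (simp add: deg del: fib_poly.simps)
  moreover have "?b ^ (Suc n * n) * resultant (?F (Suc (Suc n))) (?F (Suc (Suc (Suc n)))) =
      ?b ^ (Suc n * Suc (Suc n)) *
        (g ^ Suc n * resultant (?F (Suc (Suc n))) (?F (Suc n)))"
    using resultant_cong_right[OF fib_poly_nonzero[OF d] dvd]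
    unfolding lead_coeff_fib_poly[OF d] resultant_smult_right[OF g]
    using g by (simp only: degree_smult_eq if_False deg power_mult)
  ultimately have "?b ^ (Suc n * n) * resultant (?F (Suc (Suc (Suc n)))) (?F (Suc (Suc n))) =
      ?b ^ (Suc n * n) * (?b ^ (Suc n * Suc (Suc n)) * (g ^ Suc n * g ^ (n * Suc n div 2)))"
    by (simp only: Suc.IH ac_simps)
  \<comment> \<open>Each step contributes \<open>g ^ Suc n\<close>, so the exponents of
    \<open>g\<close> add up to triangular numbers.\<close>
  moreover have "Suc n + n * Suc n div 2 = Suc n * Suc (Suc n) div 2"
  proof -
    have "Suc n * Suc (Suc n) = n * Suc n + Suc n * 2" by simp
    then show ?thesis by (simp only: div_mult_self1 numeral_eq_Suc)
  qed
  ultimately show ?case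
    using b by (simp flip: power_add del: fib_poly.simps mult_Suc mult_Suc_right power_Suc)
qed simp

lemma degree_lead_coeff_quadratic:
  fixes d :: "'a::idom poly"
  assumes "degree d = 1"
  shows "degree (d\<^sup>2 + 4 * [:g:]) = 2 \<and> lead_coeff (d\<^sup>2 + 4 * [:g:]) = (lead_coeff d)\<^sup>2"
proof -
  have "d \<noteq> 0" using assms by force
  then have deg: "degree (d\<^sup>2) = 2" using assms by (simp add: degree_power_eq)
  then have lt: "degree (4 * [:g:]) < degree (d\<^sup>2)" by (simp add: numeral_poly)
  show ?thesis
    using lead_coeff_add_le[OF lt] degree_add_eq_right[OF lt] lead_coeff_power[of d 2]
    by (simp only: deg add.commute[of "d\<^sup>2"])
qed

lemmas degree_quadratic = degree_lead_coeff_quadratic[THEN conjunct1]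
  and lead_coeff_quadratic = degree_lead_coeff_quadratic[THEN conjunct2]

text \<open>The congruence for \<open>F_(n+1)\<close> is modulo \<open>D\<close>, so
  \<open>D\<close> is moved to the first argument, which is free of sign because its degree is even.
  What remains is \<open>resultant ?D d\<close>, found from \<open>D = 4 g\<close> modulo
  \<open>d\<close>.\<close>

lemma resultant_fib_poly_quadratic:
  fixes d :: "'a::field_char_0 poly"
  assumes d: "degree d = 1" and g: "g \<noteq> 0"
  shows "resultant (fib_poly d [:g:] (Suc n)) (d\<^sup>2 + 4 * [:g:]) =
    of_nat (Suc n) ^ 2 * ((lead_coeff d)\<^sup>2 * g) ^ n"
proof -
  let ?F = "fib_poly d [:g:]" and ?b = "lead_coeff d" and ?D = "d\<^sup>2 + 4 * [:g:]"
  have d0: "d \<noteq> 0" using d by force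
  then have b: "?b \<noteq> 0" by simp
  note degD = degree_quadratic[OF d, of g] and lcD = lead_coeff_quadratic[OF d, of g]
  have D0: "?D \<noteq> 0" using degD by force
  have swap: "resultant p ?D = resultant ?D p" for p
    using resultant_swap[of p ?D] unfolding degD by simp
  have "d dvd ?D - [:4 * g:]"
    by (simp add: power2_eq_square numeral_poly mult.commute)
  from resultant_cong_right[OF d0 this, unfolded degD] have "resultant d ?D = ?b\<^sup>2 * (4 * g)"
    by (simp add: d)
  then have Dd: "resultant ?D d = 4 * (?b\<^sup>2 * g)"
    unfolding swap[symmetric] by (simp only: mult_ac)
  let ?Q = "smult (2 ^ n) (?F (Suc n))" and ?R = "smult (of_nat (Suc n)) (d ^ n)"
  have "?Q - ?R = 2 ^ n * ?F (Suc n) - of_nat (Suc n) * d ^ n"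
    by (simp add: of_nat_poly numeral_poly poly_const_pow)
  then have dvd: "?D dvd ?Q - ?R" by (simp only: fib_poly_dvd)
  have degs: "degree ?Q = n" "degree ?R = n"
    using degree_fib_poly[OF d] d d0 by (simp_all add: degree_power_eq del: of_nat_Suc)
  \<comment> \<open>Both degrees are \<open>n\<close>, so the powers of the leading coefficient
    cancel.\<close>
  have "resultant ?D ?Q = resultant ?D ?R"
    using resultant_cong_right[OF D0 dvd] unfolding degs lcD using b by simp
  \<comment> \<open>As \<open>D\<close> has degree 2, the scalar \<open>2 ^ n\<close> enters
    squared; it cancels against the factor 4 of \<open>resultant ?D d\<close> taken \<open>n\<close>
    times.\<close>
  moreover have "((2 :: 'a) ^ n)\<^sup>2 = 4 ^ n"
    by (simp add: power2_eq_square flip: power_mult_distrib)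
  then have "resultant ?D ?Q = 4 ^ n * resultant ?D (?F (Suc n))"
    using resultant_smult_right[of "2 ^ n" ?D "?F (Suc n)"] by (simp only: degD) simp
  moreover have "resultant ?D ?R = of_nat (Suc n) ^ 2 * (4 ^ n * (?b\<^sup>2 * g) ^ n)"
    by (simp only: resultant_smult_right resultant_power_right[OF D0 d0] degD Dd power_mult_distrib
        of_nat_eq_0_iff nat.distinct not_False_eq_True)
  ultimately have "resultant ?D (?F (Suc n)) = of_nat (Suc n) ^ 2 * (?b\<^sup>2 * g) ^ n"
    by (simp del: of_nat_Suc)
  then show ?thesis by (simp only: swap)
qed

text \<open>\<open>Res(P, D) Res(P, P') = Res(P, D P')\<close>, and the right side reduces to
  consecutive terms. The square on the left comes from \<open>Res(P, D)\<close>; keeping it there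
  avoids division, and the index \<open>m + 2\<close> avoids truncated subtraction.\<close>

lemma resultant_fib_poly_pderiv:
  fixes d :: "'a::field_char_0 poly"
  assumes d: "degree d = 1" and g: "g \<noteq> 0"
  shows "of_nat (m + 2) ^ 2 *
      resultant (fib_poly d [:g:] (m + 2)) (pderiv (fib_poly d [:g:] (m + 2))) =
    (2 * of_nat (m + 2) * lead_coeff d) ^ Suc m * lead_coeff d ^ (m * Suc m) *
      g ^ (m * Suc m div 2)"
proof -
  let ?F = "fib_poly d [:g:]" and ?b = "lead_coeff d" and ?D = "d\<^sup>2 + 4 * [:g:]"
  define P where "P = ?F (m + 2)"
  \<comment> \<open>This is the coefficient \<open>2 n d'\<close> of \<open>F_(n+1)\<close> in the
    derivative identity at \<open>n = m + 2\<close>.\<close>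
  define c where "c = 2 * of_nat (m + 2) * ?b"
  define N :: 'a where "N = of_nat (m + 2)"
  define r where "r = resultant P (pderiv P)"
  have "d \<noteq> 0" using d by force
  then have b: "?b \<noteq> 0" by simp
  have N: "N \<noteq> 0" unfolding N_def of_nat_eq_0_iff by simp
  then have c: "c \<noteq> 0" unfolding c_def N_def[symmetric] using b by simp
  have P: "degree P = Suc m" "lead_coeff P = ?b ^ Suc m"
    using degree_fib_poly[OF d, of g "Suc m"] lead_coeff_fib_poly[OF d, of g "Suc m"]
    by (simp_all add: P_def del: fib_poly.simps)
  then have P0: "P \<noteq> 0" and degP': "degree (pderiv P) = m" and P'0: "pderiv P \<noteq> 0"
    by (auto simp: degree_pderiv pderiv_eq_0_iff)
  have D0: "?D \<noteq> 0" using degree_quadratic[OF d, of g] by force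
  have D: "resultant P ?D = N ^ 2 * (?b\<^sup>2 * g) ^ Suc m"
    using resultant_fib_poly_quadratic[OF d g, of "Suc m"] by (simp add: P_def N_def)
  have pd: "pderiv d = [:?b:]"
    by (rule poly_eqI) (use d in \<open>auto simp: coeff_pderiv coeff_pCons coeff_eq_0 split: nat.splits\<close>)
  \<comment> \<open>Expanding \<open>F_(m+3)\<close> as \<open>d P + g F_(m+1)\<close> in the
    derivative identity leaves only multiples of \<open>P\<close> besides the term in
    \<open>F_(m+1)\<close>.\<close>
  have "?D * pderiv P - smult (c * g) (?F (Suc m)) =
      P * (pderiv d * d * (of_nat (2 * (m + 2)) - of_nat (m + 3)))"
  proof -
    define Y where "Y = [:g:] * ?F (Suc m)"
    have F: "?F (Suc (m + 2)) = d * P + Y" by (simp add: P_def Y_def)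
    have sm: "smult (c * g) (?F (Suc m)) = pderiv d * of_nat (2 * (m + 2)) * Y"
      unfolding pd of_nat_poly c_def Y_def by (simp add: mult_ac del: fib_poly.simps)
    have "pderiv [:g:] = 0" by (simp add: pderiv_pCons)
    then have "?D * pderiv P = pderiv d * (of_nat (2 * (m + 2)) * (d * P + Y) - of_nat (m + 3) * d * P)"
      using fib_poly_pderiv[of "[:g:]" d "m + 2", folded P_def, unfolded F]
      by (simp only: numeral_eq_Suc pred_numeral_simps add_Suc_right add_0_right)
    then show ?thesis unfolding sm by (simp only: algebra_simps)
  qed
  then have "P dvd ?D * pderiv P - smult (c * g) (?F (Suc m))" by simp
  note cong = resultant_cong_right[OF P0 this]
  have "degree (?D * pderiv P) = m + 2"
    using degree_quadratic[OF d, of g] P'0 degP' by (subst degree_mult_eq) auto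
  moreover have "degree (smult (c * g) (?F (Suc m))) = m"
    using c g by (simp add: degree_fib_poly[OF d] del: fib_poly.simps)
  moreover have "resultant P (smult (c * g) (?F (Suc m))) =
      (c * g) ^ Suc m * resultant P (?F (Suc m))"
    using c g by (simp only: resultant_smult_right P mult_eq_0_iff simp_thms)
  ultimately have "?b ^ (Suc m * m) * resultant P (?D * pderiv P) =
      ?b ^ (Suc m * (m + 2)) * ((c * g) ^ Suc m * resultant P (?F (Suc m)))"
    using cong unfolding P(2) by (simp only: power_mult)
  moreover have "resultant P (?D * pderiv P) = N ^ 2 * (?b\<^sup>2 * g) ^ Suc m * r"
    by (simp only: resultant_mult_right[OF P0 D0 P'0] D r_def)
  moreover have "resultant P (?F (Suc m)) = ?b ^ (m * Suc m) * g ^ (m * Suc m div 2)"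
    using resultant_fib_poly_consecutive[OF d g, of m] by (simp add: P_def)
  ultimately have "?b ^ (Suc m * m) * (N ^ 2 * (?b\<^sup>2 * g) ^ Suc m * r) =
      ?b ^ (Suc m * (m + 2)) *
        ((c * g) ^ Suc m * (?b ^ (m * Suc m) * g ^ (m * Suc m div 2)))"
    by simp
  \<comment> \<open>This splitting exposes the same nonzero factor on both sides, ready to be
    cancelled.\<close>
  moreover have "?b ^ (Suc m * (m + 2)) = ?b ^ (Suc m * m) * (?b\<^sup>2) ^ Suc m"
    by (simp only: distrib_left power_add power_mult[of ?b 2, symmetric] mult.commute[of 2])
  ultimately have "(?b ^ (Suc m * m) * (?b\<^sup>2) ^ Suc m * g ^ Suc m) * (N ^ 2 * r) =
      (?b ^ (Suc m * m) * (?b\<^sup>2) ^ Suc m * g ^ Suc m) *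
        (c ^ Suc m * ?b ^ (m * Suc m) * g ^ (m * Suc m div 2))"
    by (simp only: power_mult_distrib mult_ac)
  then have "N ^ 2 * r = c ^ Suc m * ?b ^ (m * Suc m) * g ^ (m * Suc m div 2)"
    using b g by (simp del: power_Suc)
  then show ?thesis unfolding N_def r_def P_def c_def .
qed

section \<open>The discriminant\<close>

text \<open>The sign exponent of the discriminant coincides with the exponent of \<open>g\<close>,
  giving a power of \<open>- g\<close>. Integer exponents are used because \<open>m - 1\<close> is
  negative at \<open>m = 0\<close>.\<close>

lemma poly_disc_fib_poly:
  fixes d :: "'a::field_char_0 poly"
  assumes d: "degree d = 1" and g: "g \<noteq> 0"
  shows "poly_disc (fib_poly d [:g:] (m + 2)) =
    (- g) ^ (m * Suc m div 2) * (2 * lead_coeff d) ^ Suc m *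
    of_nat (m + 2) powi (int m - 1) * lead_coeff d powi ((int m + 1) * (int m - 1))"
proof -
  let ?b = "lead_coeff d" and ?N = "of_nat (m + 2) :: 'a" and ?k = "m * Suc m div 2"
  define P where "P = fib_poly d [:g:] (m + 2)"
  have "d \<noteq> 0" using d by force
  then have b: "?b \<noteq> 0" by simp
  have N: "?N \<noteq> 0" unfolding of_nat_eq_0_iff by simp
  have P: "degree P = Suc m" "lead_coeff P = ?b ^ Suc m"
    using degree_fib_poly[OF d, of g "Suc m"] lead_coeff_fib_poly[OF d, of g "Suc m"]
    by (simp_all add: P_def del: fib_poly.simps)
  \<comment> \<open>The subtracted \<open>Suc m\<close> accounts for the inverse of
    \<open>lead_coeff P\<close>; likewise the 2 subtracted below accounts for the division by
    \<open>?N ^ 2\<close>.\<close>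
  have "(int m + 1) * (int m - 1) = int (m * Suc m) - int (Suc m)"
    by (simp add: algebra_simps)
  then have bp: "?b powi ((int m + 1) * (int m - 1)) = ?b ^ (m * Suc m) / ?b ^ Suc m"
    by (simp only: power_int_diff[OF disjI1[OF b]] power_int_of_nat)
  have "int m - 1 = int (Suc m) - int 2" by simp
  then have Np: "?N powi (int m - 1) = ?N ^ Suc m / ?N ^ 2"
    by (simp only: power_int_diff[OF disjI1[OF N]] power_int_of_nat)
  have res: "resultant P (pderiv P) =
      (2 * ?N * ?b) ^ Suc m * ?b ^ (m * Suc m) * g ^ ?k / ?N ^ 2"
    using resultant_fib_poly_pderiv[OF d g, of m] N unfolding P_def
    by (simp only: nonzero_eq_divide_eq[OF power_not_zero[OF N]] mult.commute)
  have "poly_disc P = (-1) ^ ?k * inverse (?b ^ Suc m) *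
      ((2 * ?N * ?b) ^ Suc m * ?b ^ (m * Suc m) * g ^ ?k / ?N ^ 2)"
    unfolding poly_disc_def P(2) unfolding P(1) res
    by (simp only: diff_Suc_1 mult.commute[of "Suc m" m])
  also have "\<dots> = (- g) ^ ?k * (2 * ?b) ^ Suc m * ?N powi (int m - 1) *
      ?b powi ((int m + 1) * (int m - 1))"
    unfolding bp Np power_minus[of g] power_mult_distrib
    by (simp only: divide_inverse mult_ac)
  finally show ?thesis unfolding P_def .
qed

theorem theorem4:
  fixes d :: "rat poly" and g :: rat and n :: nat
  assumes "degree d = 1" and "g \<noteq> 0" and "n \<ge> 2"
  shows "poly_disc (fib_poly d [:g:] n) =
      (- resultant [:g:] d) ^ ((n - 2) * (n - 1) div 2)
      * (2 * coeff (pderiv d) 0) ^ (n - 1)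
      * of_nat n powi (int n - 3)
      * lead_coeff d powi ((int n - 1) * (int n - 3))"
proof -
  obtain m where n: "n = m + 2" using assms(3) by (metis le_add_diff_inverse2)
  \<comment> \<open>For linear \<open>d\<close> the derivative is its leading coefficient, and the
    resultant with a constant is \<open>g ^ degree d\<close>, that is \<open>g\<close>.\<close>
  have "coeff (pderiv d) 0 = lead_coeff d" by (simp add: coeff_pderiv assms(1))
  moreover have "resultant [:g:] d = g" by (simp add: assms(1))
  ultimately show ?thesis
    using poly_disc_fib_poly[OF assms(1,2), of m] by (simp add: n add.commute)
qed

end
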